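(* Let $(W,S)$ be an irreducible finite Coxeter group of rank $n\ge 2$ and let $m=\max\{m(s,t) : s,t\in S\}$. Let $X_{\mathrm{des}}$ be the number of $W$-descents of an element $w\in W$ chosen uniformly at random. Then \[ \mathbb{E}(X_{\mathrm{des}}) = n/2,\qquad \mathbb{V}(X_{\mathrm{des}}) = \frac{n-2}{12}+\frac1m. \]
   Context: $m(s,t)$ denotes the order of $st$ in $W$ (so $2m$ is the maximal size of a dihedral parabolic subgroup of $W$). Fix a root system $\Phi=\Phi^+\sqcup\Phi^-$ for $(W,S)$ with simple roots $\Delta$. For $w\in W$, $\mathrm{Des}(w)=\{\beta\in\Delta : w(\beta)\in\Phi^-\}$ and $\mathrm{des}(w)=\#\mathrm{Des}(w)$. *)

theory Defs
  imports Complex_Main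
begin

text \<open>A Coxeter system of rank n is given (up to isomorphism) by its Coxeter matrix M,
  indexed by 0..<n. Since we only consider finite Coxeter groups, all entries are finite.\<close>

definition coxeter_matrix :: "nat \<Rightarrow> (nat \<Rightarrow> nat \<Rightarrow> nat) \<Rightarrow> bool" where
  "coxeter_matrix n M \<longleftrightarrow>
     (\<forall>i<n. M i i = 1) \<and>
     (\<forall>i<n. \<forall>j<n. M i j = M j i) \<and>
     (\<forall>i<n. \<forall>j<n. i \<noteq> j \<longrightarrow> M i j \<ge> 2)"

text \<open>Irreducible: the Coxeter graph (edges where m(s,t) >= 3) is connected.\<close>
definition coxeter_irreducible :: "nat \<Rightarrow> (nat \<Rightarrow> nat \<Rightarrow> nat) \<Rightarrow> bool" where
  "coxeter_irreducible n M \<longleftrightarrow>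
     (\<forall>i<n. \<forall>j<n. (i, j) \<in> {(a, b). a < n \<and> b < n \<and> M a b \<ge> 3}\<^sup>*)"

text \<open>Geometric (Tits) representation on V with basis alpha_0..alpha_{n-1};
  vectors are coefficient functions nat => real.\<close>
definition cox_bil :: "(nat \<Rightarrow> nat \<Rightarrow> nat) \<Rightarrow> nat \<Rightarrow> nat \<Rightarrow> real" where
  "cox_bil M i j = - cos (pi / real (M i j))"

definition simple_root :: "nat \<Rightarrow> nat \<Rightarrow> real" where
  "simple_root i = (\<lambda>k. if k = i then 1 else 0)"

definition cox_refl :: "nat \<Rightarrow> (nat \<Rightarrow> nat \<Rightarrow> nat) \<Rightarrow> nat \<Rightarrow> (nat \<Rightarrow> real) \<Rightarrow> (nat \<Rightarrow> real)" where
  "cox_refl n M i v = (\<lambda>k. if k = i then v k - 2 * (\<Sum>j<n. cox_bil M i j * v j) else v k)"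

text \<open>W = the group generated by the simple reflections (they are involutions, so
  the generated monoid is the generated group).\<close>
inductive_set cox_group :: "nat \<Rightarrow> (nat \<Rightarrow> nat \<Rightarrow> nat) \<Rightarrow> ((nat \<Rightarrow> real) \<Rightarrow> (nat \<Rightarrow> real)) set"
  for n M where
  id_in: "id \<in> cox_group n M"
| step: "w \<in> cox_group n M \<Longrightarrow> i < n \<Longrightarrow> cox_refl n M i \<circ> w \<in> cox_group n M"

text \<open>Des(w) = simple roots beta with w(beta) a negative root (all coefficients <= 0).\<close>
definition cox_Des :: "nat \<Rightarrow> ((nat \<Rightarrow> real) \<Rightarrow> (nat \<Rightarrow> real)) \<Rightarrow> nat set" where
  "cox_Des n w = {i. i < n \<and> (\<forall>k. w (simple_root i) k \<le> 0)}"

definition cox_des :: "nat \<Rightarrow> ((nat \<Rightarrow> real) \<Rightarrow> (nat \<Rightarrow> real)) \<Rightarrow> nat" where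
  "cox_des n w = card (cox_Des n w)"

definition des_mean :: "nat \<Rightarrow> (nat \<Rightarrow> nat \<Rightarrow> nat) \<Rightarrow> real" where
  "des_mean n M = (\<Sum>w\<in>cox_group n M. real (cox_des n w)) / real (card (cox_group n M))"

definition des_var :: "nat \<Rightarrow> (nat \<Rightarrow> nat \<Rightarrow> nat) \<Rightarrow> real" where
  "des_var n M = (\<Sum>w\<in>cox_group n M. (real (cox_des n w) - des_mean n M)\<^sup>2)
                   / real (card (cox_group n M))"

end

theory Submission
  imports Defs
begin

text \<open>Write the number of descents as a sum of indicators. For simple roots \<open>p \<noteq> q\<close>, the elements
  \<open>w, w s\<^sub>p, w s\<^sub>p s\<^sub>q, \<dots>\<close> (\<open>2 m(p,q)\<close> steps) contain exactly one with both descents, so this joint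
  event has probability \<open>1 / (2 m(p,q))\<close>, and the variance is the sum of
  \<open>1 / (2 m(p,q)) - 1 / 4\<close> over all ordered pairs, with \<open>m(p,p) = 1\<close>. Averaging shows that the Tits
  form is positive definite, which forces the Coxeter graph to be a tree in which at most one
  edge has a label above 3. Hence, starting from an edge with the largest label \<open>m\<close> (which contributes
  \<open>1 / m\<close>), each further vertex contributes \<open>1 / 4 - 2 / 12 = 1 / 12\<close>.\<close>

text \<open>By antiperiodicity the \<open>m\<close> negative values after a drop are followed by
  \<open>m\<close> positive ones, so no second drop fits into one period \<open>2 * m\<close>. A
  drop exists because \<open>g\<close> turns negative at most \<open>m\<close> steps after any
  positive value.\<close>

lemma unique_sign_change:
  fixes g :: "nat \<Rightarrow> real"
  assumes anti: "\<And>k. g (k + m) = - g k" and nonzero: "\<And>k. g k \<noteq> 0"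
    and neg: "\<And>k j. g k > 0 \<Longrightarrow> g (Suc k) < 0 \<Longrightarrow> j < m \<Longrightarrow> g (Suc k + j) < 0"
  shows "\<exists>!k. k < 2 * m \<and> g k > 0 \<and> g (Suc k) < 0"
proof -
  have ex: "\<exists>k. b \<le> k \<and> k < b + m \<and> g k > 0 \<and> g (Suc k) < 0" if gb: "g b > 0" for b
  proof -
    define l where "l = (LEAST l. g (b + l) < 0)"
    have bm: "g (b + m) < 0" using anti that by simp
    have l: "g (b + l) < 0" "l \<le> m" unfolding l_def
      by (rule LeastI[of "\<lambda>l. g (b + l) < 0"], fact) (rule Least_le, fact)
    then obtain l' where l': "l = Suc l'" using gb by (cases l) auto
    have "\<not> g (b + l') < 0" using not_less_Least[of l' "\<lambda>l. g (b + l) < 0"] l' by (simp add: l_def)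
    then show ?thesis using l l' nonzero[of "b + l'"] by (intro exI[of _ "b + l'"]) auto
  qed
  have False if "k < k'" "k' < 2 * m" "g k > 0" "g (Suc k) < 0" "g k' > 0" "g (Suc k') < 0" for k k'
  proof (cases "k' \<le> k + m")
    case True
    then have "k' - Suc k < m" using that(1) by linarith
    then show False using neg[of k "k' - Suc k"] that by simp
  next
    case False
    then have "g (Suc k + (k' - k - m)) < 0" using that by (intro neg) auto
    then have "g (Suc k + (k' - k - m) + m) > 0" unfolding anti by simp
    then show False using that False by simp
  qed
  then have uniq: "k = k'" if "k < 2 * m" "k' < 2 * m" "g k > 0" "g (Suc k) < 0" "g k' > 0" "g (Suc k') < 0"
    for k k' using that by (meson linorder_neqE_nat)
  have "\<exists>k. k < 2 * m \<and> g k > 0 \<and> g (Suc k) < 0"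
  proof (cases "g 0 > 0")
    case True
    from ex[OF this] obtain k where "k < 0 + m" "g k > 0" "g (Suc k) < 0" by blast
    then show ?thesis by (intro exI[of _ k]) simp
  next
    case False
    then have "g m > 0" using anti[of 0] nonzero[of 0] by simp
    from ex[OF this] obtain k where "k < m + m" "g k > 0" "g (Suc k) < 0" by blast
    then show ?thesis by (intro exI[of _ k]) simp
  qed
  then show ?thesis using uniq by blast
qed

section \<open>The invariant form\<close>

locale finite_coxeter =
  fixes n :: nat and M :: "nat \<Rightarrow> nat \<Rightarrow> nat"
  assumes cm: "coxeter_matrix n M"
    and fin: "finite (cox_group n M)"
begin

abbreviation G where "G \<equiv> cox_group n M"
abbreviation s where "s \<equiv> cox_refl n M"
abbreviation \<alpha> where "\<alpha> \<equiv> simple_root"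

text \<open>The Tits form paired with the \<open>i\<close>-th simple root; \<open>s i\<close>
  subtracts twice this multiple of \<open>\<alpha> i\<close>.\<close>

definition L :: "nat \<Rightarrow> (nat \<Rightarrow> real) \<Rightarrow> real" where
  "L i x = (\<Sum>j<n. cox_bil M i j * x j)"

lemma M_diag: "i < n \<Longrightarrow> M i i = 1"
  and M_sym: "i < n \<Longrightarrow> j < n \<Longrightarrow> M i j = M j i"
  and M_ge2: "i < n \<Longrightarrow> j < n \<Longrightarrow> i \<noteq> j \<Longrightarrow> M i j \<ge> 2"
  using cm by (auto simp: coxeter_matrix_def)

lemma cox_bil_diag: "i < n \<Longrightarrow> cox_bil M i i = 1"
  by (simp add: cox_bil_def M_diag)

lemma cox_bil_sym: "i < n \<Longrightarrow> j < n \<Longrightarrow> cox_bil M i j = cox_bil M j i"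
  by (simp add: cox_bil_def M_sym)

lemma L_simple_root: "j < n \<Longrightarrow> L i (\<alpha> j) = cox_bil M i j"
  by (simp add: L_def simple_root_def if_distrib[of "\<lambda>x. _ * x"] cong: if_cong)

lemma L_linear: "L i (\<lambda>k. a * x k + b * y k) = a * L i x + b * L i y"
  by (simp add: L_def sum.distrib sum_distrib_left algebra_simps)

lemma refl_eq: "s i x = (\<lambda>k. 1 * x k + (- 2 * L i x) * \<alpha> i k)"
  by (auto simp: cox_refl_def L_def simple_root_def)

lemma refl_linear: "s i (\<lambda>k. a * x k + b * y k) = (\<lambda>k. a * s i x k + b * s i y k)"
  unfolding refl_eq L_linear by (auto simp: algebra_simps)

lemma refl_simple_root: "i < n \<Longrightarrow> s i (\<alpha> i) = (\<lambda>k. - \<alpha> i k)"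
  by (simp add: refl_eq L_simple_root cox_bil_diag)

lemma refl_refl: assumes "i < n" shows "s i (s i x) = x"
proof -
  have "s i (s i x) = s i (\<lambda>k. 1 * x k + (- 2 * L i x) * \<alpha> i k)"
    by (simp only: refl_eq[of i x])
  also have "\<dots> = x"
    unfolding refl_linear refl_simple_root[OF assms] by (subst refl_eq) auto
  finally show ?thesis .
qed

lemma refl_comp_refl: "i < n \<Longrightarrow> s i \<circ> s i = id"
  by (auto simp: refl_refl)

lemma comp_refl_refl: "i < n \<Longrightarrow> w \<circ> s i \<circ> s i = w"
  by (auto simp: refl_refl)

lemma refl_in_group: "i < n \<Longrightarrow> s i \<in> G"
  using cox_group.step[OF cox_group.id_in, of i n M] by simp

lemma comp_in_group: "v \<in> G \<Longrightarrow> w \<in> G \<Longrightarrow> v \<circ> w \<in> G"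
  by (induction rule: cox_group.induct) (auto simp: comp_assoc intro: cox_group.intros)

lemma group_linear:
  "w \<in> G \<Longrightarrow> w (\<lambda>k. a * x k + b * y k) = (\<lambda>k. a * w x k + b * w y k)"
  by (induction rule: cox_group.induct) (auto simp: refl_linear)

lemma group_minus: "w \<in> G \<Longrightarrow> w (\<lambda>k. - x k) = (\<lambda>k. - w x k)"
  using group_linear[of w "-1" x 0 x] by simp

lemma group_scale: "w \<in> G \<Longrightarrow> w (\<lambda>k. a * x k) = (\<lambda>k. a * w x k)"
  using group_linear[of w a x 0 x] by simp

lemma group_outside: "w \<in> G \<Longrightarrow> k \<ge> n \<Longrightarrow> w x k = x k"
  by (induction rule: cox_group.induct) (auto simp: cox_refl_def)

text \<open>Coordinates from \<open>n\<close> on are fixed by the group and invisible to the simple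
  roots, hence the bound on \<open>k\<close>.\<close>

lemma group_expand:
  "w \<in> G \<Longrightarrow> k < n \<Longrightarrow> w x k = (\<Sum>j<n. x j * w (\<alpha> j) k)"
proof (induction arbitrary: k rule: cox_group.induct)
  case id_in
  then show ?case
    by (simp add: simple_root_def if_distrib[of "\<lambda>x. _ * x"] cong: if_cong)
next
  case (step w i)
  have "L i (w x) = (\<Sum>j<n. \<Sum>l<n. cox_bil M i j * (x l * w (\<alpha> l) j))"
    by (simp add: L_def step.IH sum_distrib_left)
  also have "\<dots> = (\<Sum>l<n. x l * L i (w (\<alpha> l)))"
    by (subst sum.swap) (simp add: L_def sum_distrib_left mult_ac)
  finally have "s i (w x) k = (\<Sum>j<n. x j * w (\<alpha> j) k) - 2 * (\<Sum>j<n. x j * L i (w (\<alpha> j))) * \<alpha> i k"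
    by (simp add: refl_eq step)
  also have "\<dots> = (\<Sum>j<n. x j * s i (w (\<alpha> j)) k)"
    by (simp add: refl_eq sum_subtractf sum_distrib_left sum_distrib_right right_diff_distrib mult_ac)
  finally show ?case by simp
qed

lemma bij_comp_group:
  assumes "u \<in> G" "v \<in> G" "u \<circ> v = id" "v \<circ> u = id"
  shows "bij_betw (\<lambda>w. w \<circ> u) G G"
  by (rule bij_betw_byWitness[where f' = "\<lambda>w. w \<circ> v"])
     (use assms in \<open>auto simp: comp_assoc comp_in_group\<close>)

lemma sum_comp_refl: "i < n \<Longrightarrow> (\<Sum>w\<in>G. F (w \<circ> s i)) = (\<Sum>w\<in>G. F w)"
  by (intro sum.reindex_bij_betw bij_comp_group[of _ "s i"])
     (auto simp: refl_in_group refl_comp_refl)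

text \<open>The standard inner product of the first \<open>n\<close> coordinates, summed over the
  finite group: an invariant form, positive definite on these coordinates.\<close>

definition A :: "(nat \<Rightarrow> real) \<Rightarrow> (nat \<Rightarrow> real) \<Rightarrow> real" where
  "A x y = (\<Sum>w\<in>G. \<Sum>k<n. w x k * w y k)"

lemma A_sym: "A x y = A y x"
  by (simp add: A_def mult.commute)

lemma A_linear: "A (\<lambda>k. a * x k + b * y k) z = a * A x z + b * A y z"
  by (simp add: A_def group_linear sum.distrib sum_distrib_left algebra_simps)

lemma A_linear_right: "A z (\<lambda>k. a * x k + b * y k) = a * A z x + b * A z y"
  using A_linear A_sym by metis

lemma A_scale_right: "A z (\<lambda>k. a * x k) = a * A z x"
  using A_linear_right[of z a x 0 x] by simp

lemma A_refl: "i < n \<Longrightarrow> A (s i x) (s i y) = A x y"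
  using sum_comp_refl[of i "\<lambda>w. \<Sum>k<n. w x k * w y k"] by (simp add: A_def)

lemma A_group: "w \<in> G \<Longrightarrow> A (w x) (w y) = A x y"
  by (induction rule: cox_group.induct) (auto simp: A_refl)

lemma A_pos: assumes "k < n" "x k \<noteq> 0" shows "A x x > 0"
proof -
  have "0 < (\<Sum>k<n. x k * x k)"
    by (rule sum_pos2[of _ k]) (use assms in \<open>auto simp: zero_less_mult_iff linorder_neq_iff\<close>)
  then show ?thesis unfolding A_def
    by (intro sum_pos2[OF fin cox_group.id_in]) (auto intro!: sum_nonneg)
qed

text \<open>\<open>s i\<close> preserves \<open>A\<close> and negates \<open>\<alpha> i\<close>, so
  it is the \<open>A\<close>-orthogonal reflection; comparing with its defining formula identifies
  \<open>L i\<close> up to scale.\<close>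

lemma A_simple_root: assumes "i < n" shows "A x (\<alpha> i) = A (\<alpha> i) (\<alpha> i) * L i x"
proof -
  have "A x (\<alpha> i) = A (s i x) (s i (\<alpha> i))" by (simp add: A_refl assms)
  also have "\<dots> = A (s i x) (\<lambda>k. (-1) * \<alpha> i k + 0 * \<alpha> i k)"
    by (simp add: refl_simple_root assms)
  also have "\<dots> = - A (s i x) (\<alpha> i)" unfolding A_linear_right by simp
  also have "\<dots> = - A x (\<alpha> i) + 2 * L i x * A (\<alpha> i) (\<alpha> i)"
    unfolding refl_eq A_linear by simp
  finally show ?thesis by simp
qed

lemma A_simple_root_pos: "i < n \<Longrightarrow> A (\<alpha> i) (\<alpha> i) > 0"
  by (rule A_pos[of i]) (auto simp: simple_root_def)

lemma A_expand: "A x y = (\<Sum>j<n. y j * A x (\<alpha> j))"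
proof -
  have "A x y = (\<Sum>w\<in>G. \<Sum>k<n. \<Sum>j<n. w x k * (y j * w (\<alpha> j) k))"
    by (simp add: A_def group_expand[of _ _ y] sum_distrib_left)
  also have "\<dots> = (\<Sum>w\<in>G. \<Sum>j<n. \<Sum>k<n. w x k * (y j * w (\<alpha> j) k))"
    by (intro sum.cong refl sum.swap)
  also have "\<dots> = (\<Sum>j<n. \<Sum>w\<in>G. \<Sum>k<n. w x k * (y j * w (\<alpha> j) k))"
    by (rule sum.swap)
  finally show ?thesis by (simp add: A_def sum_distrib_left mult_ac)
qed

lemma root_nonzero: assumes "w \<in> G" "i < n" shows "\<exists>k<n. w (\<alpha> i) k \<noteq> 0"
proof (rule ccontr)
  assume "\<not> ?thesis"
  then have "A (w (\<alpha> i)) (w (\<alpha> i)) = 0" by (subst A_expand) simp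
  then show False using A_group A_simple_root_pos assms by force
qed

definition Q :: "(nat \<Rightarrow> real) \<Rightarrow> real" where "Q x = (\<Sum>i<n. x i * L i x)"

text \<open>\<open>A\<close> is a positive multiple of the Tits form: they agree up to a scale at
  each simple root, and connectedness makes these scales equal.\<close>

lemma Q_pos:
  assumes irr: "coxeter_irreducible n M" and k: "k < n" "x k \<noteq> 0"
  shows "Q x > 0"
proof -
  \<comment> \<open>On an edge both forms are symmetric and \<open>cox_bil M i j\<close> is nonzero,
    which forces equal scales.\<close>
  have eq: "A (\<alpha> i) (\<alpha> i) = A (\<alpha> j) (\<alpha> j)" if "i < n" "j < n" "M i j \<ge> 3" for i j
  proof -
    have "cos (pi / real (M i j)) > 0"
      using that by (intro cos_gt_zero) (auto simp: field_simps)
    then have "cox_bil M i j \<noteq> 0" by (simp add: cox_bil_def)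
    moreover have "A (\<alpha> i) (\<alpha> i) * cox_bil M i j = A (\<alpha> j) (\<alpha> j) * cox_bil M j i"
      using A_simple_root[of i "\<alpha> j"] A_simple_root[of j "\<alpha> i"] A_sym[of "\<alpha> i" "\<alpha> j"] that
      by (simp add: L_simple_root)
    ultimately show ?thesis using cox_bil_sym that by auto
  qed
  have all: "A (\<alpha> i) (\<alpha> i) = A (\<alpha> k) (\<alpha> k)" if "i < n" for i
  proof -
    have "(i, k) \<in> {(a, b). a < n \<and> b < n \<and> M a b \<ge> 3}\<^sup>*"
      using irr that k by (auto simp: coxeter_irreducible_def)
    then show ?thesis by (induction rule: rtrancl_induct) (auto simp: eq)
  qed
  have "A x x = A (\<alpha> k) (\<alpha> k) * Q x"
    by (subst A_expand) (simp add: A_simple_root[of _ x] all Q_def sum_distrib_left mult_ac)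
  then show ?thesis using A_pos[of k x] k A_simple_root_pos[OF k(1)] by (simp add: zero_less_mult_iff)
qed

section \<open>Images of simple roots are positive or negative\<close>

text \<open>Letters are appended on the right, since descents compare \<open>w\<close> with
  \<open>w \<circ> s i\<close>, whereas \<open>cox_group\<close> grows on the left;
  \<open>refl_comp_words\<close> bridges the two.\<close>

primrec words :: "nat \<Rightarrow> ((nat \<Rightarrow> real) \<Rightarrow> (nat \<Rightarrow> real)) set" where
  "words 0 = {id}"
| "words (Suc k) = (\<Union>w\<in>words k. (\<lambda>i. w \<circ> s i) ` {..<n})"

lemma refl_comp_words: "w \<in> words k \<Longrightarrow> i < n \<Longrightarrow> s i \<circ> w \<in> words (Suc k)"
proof (induction k arbitrary: w)
  case (Suc k)
  then obtain v j where v: "v \<in> words k" "j < n" "w = v \<circ> s j" by auto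
  then have "s i \<circ> w = (s i \<circ> v) \<circ> s j" by (simp add: comp_assoc)
  then show ?case using Suc.IH[OF v(1) Suc.prems(2)] v(2) unfolding words.simps(2)[of "Suc k"]
    by blast
qed force

lemma group_words: "w \<in> G \<Longrightarrow> \<exists>k. w \<in> words k"
proof (induction rule: cox_group.induct)
  case id_in
  have "id \<in> words 0" by simp
  then show ?case by blast
next
  case (step w i)
  then show ?case using refl_comp_words by blast
qed

definition len :: "((nat \<Rightarrow> real) \<Rightarrow> (nat \<Rightarrow> real)) \<Rightarrow> nat" where
  "len w = (LEAST k. w \<in> words k)"

lemma words_len: "w \<in> G \<Longrightarrow> w \<in> words (len w)"
  unfolding len_def by (rule LeastI_ex) (rule group_words)

lemma len_le: "w \<in> words k \<Longrightarrow> len w \<le> k"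
  unfolding len_def by (rule Least_le)

lemma len_comp_refl_le: assumes "w \<in> G" "i < n" shows "len (w \<circ> s i) \<le> len w + 1"
  by (rule len_le) (use words_len[OF assms(1)] assms(2) in auto)

lemma len_le_comp_refl: assumes "w \<in> G" "i < n" shows "len w \<le> len (w \<circ> s i) + 1"
  using len_comp_refl_le[of "w \<circ> s i" i] assms
  by (simp add: comp_refl_refl comp_in_group refl_in_group)

section \<open>Alternating words in two generators\<close>

primrec alt :: "nat \<Rightarrow> nat \<Rightarrow> nat \<Rightarrow> (nat \<Rightarrow> real) \<Rightarrow> (nat \<Rightarrow> real)" where
  "alt p q 0 = id"
| "alt p q (Suc k) = alt p q k \<circ> s (if even k then p else q)"

lemma alt_left: "alt p q (Suc k) = s p \<circ> alt q p k"
proof (induction k)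
  case (Suc k)
  have "alt p q (Suc (Suc k)) = s p \<circ> (alt q p k \<circ> s (if even k then q else p))"
    by (subst alt.simps(2), subst Suc) (simp add: comp_assoc)
  then show ?case by simp
qed simp

lemma alt_in_group: "p < n \<Longrightarrow> q < n \<Longrightarrow> alt p q k \<in> G"
  by (induction k) (auto intro: cox_group.id_in comp_in_group refl_in_group)

lemma len_alt:
  assumes "w \<in> G" "p < n" "q < n"
  shows "len (w \<circ> alt p q k) \<le> len w + k" "len w \<le> len (w \<circ> alt p q k) + k"
proof (induction k)
  case (Suc k)
  define r where "r = (if even k then p else q)"
  have "w \<circ> alt p q (Suc k) = w \<circ> alt p q k \<circ> s r" by (simp add: r_def comp_assoc)
  moreover have "w \<circ> alt p q k \<in> G" "r < n"
    using assms by (simp_all add: comp_in_group alt_in_group r_def)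
  ultimately have "len (w \<circ> alt p q (Suc k)) \<le> len (w \<circ> alt p q k) + 1"
    "len (w \<circ> alt p q k) \<le> len (w \<circ> alt p q (Suc k)) + 1"
    using len_comp_refl_le len_le_comp_refl by metis+
  with Suc show "len (w \<circ> alt p q (Suc k)) \<le> len w + Suc k"
    "len w \<le> len (w \<circ> alt p q (Suc k)) + Suc k" by linarith+
qed simp_all

section \<open>The dihedral action on the plane of two simple roots\<close>

definition angle :: "nat \<Rightarrow> nat \<Rightarrow> real" where "angle p q = pi / real (M p q)"

text \<open>For distinct \<open>p\<close> and \<open>q\<close> this is, in the Tits form, the point
  at angle \<open>x\<close> on a circle of radius \<open>sin (angle p q)\<close>, with
  \<open>\<alpha> p\<close> in direction 0 and \<open>\<alpha> q\<close> in direction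
  \<open>pi - angle p q\<close>.\<close>

definition plane :: "nat \<Rightarrow> nat \<Rightarrow> real \<Rightarrow> nat \<Rightarrow> real" where
  "plane p q x = (\<lambda>k. sin (x + angle p q) * \<alpha> p k + sin x * \<alpha> q k)"

lemma angle_sym: "p < n \<Longrightarrow> q < n \<Longrightarrow> angle q p = angle p q"
  by (simp add: angle_def M_sym)

lemma plane_swap: "p < n \<Longrightarrow> q < n \<Longrightarrow> plane q p x = (\<lambda>k. - plane p q (- x - angle p q) k)"
proof -
  have "- x - t = - (x + t)" for t :: real by simp
  then have "sin (- x - t) = - sin (x + t)" for t by (simp only: sin_minus)
  then show "p < n \<Longrightarrow> q < n \<Longrightarrow> ?thesis" by (auto simp: plane_def angle_sym)
qed

lemma sin_angle_pos: assumes "p < n" "q < n" "p \<noteq> q" shows "sin (angle p q) > 0"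
  unfolding angle_def using M_ge2[OF assms] by (intro sin_gt_zero) (auto simp: field_simps)

lemma sin_multiple_nonneg:
  assumes "p < n" "q < n" "p \<noteq> q" "k \<le> M p q" shows "sin (real k * angle p q) \<ge> 0"
  unfolding angle_def using M_ge2[OF assms(1-3)] assms(4) by (intro sin_ge_zero) (auto simp: field_simps)

lemma M_angle: assumes "p < n" "q < n" "p \<noteq> q" shows "real (M p q) * angle p q = pi"
  unfolding angle_def using M_ge2[OF assms] by simp

lemma plane_0: "plane p q 0 = (\<lambda>k. sin (angle p q) * \<alpha> p k)"
  by (simp add: plane_def)

lemma plane_minus: "plane p q (- angle p q) = (\<lambda>k. - sin (angle p q) * \<alpha> q k)"
  by (simp add: plane_def)

lemma refl_plane_left:
  assumes "p < n" "q < n" shows "s p (plane p q x) = (\<lambda>k. - plane p q (- x) k)"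
proof -
  define t where "t = angle p q"
  have L: "L p (plane p q x) = sin (x + t) - cos t * sin x"
    using assms unfolding plane_def L_linear
    by (simp add: L_simple_root cox_bil_diag) (simp add: cox_bil_def angle_def t_def)
  have "sin (x + t) - 2 * (sin (x + t) - cos t * sin x) = - sin (t - x)"
    by (simp add: sin_add sin_diff)
  then have "(sin (x + t) - 2 * (sin (x + t) - cos t * sin x)) * a = - sin (t - x) * a" for a
    by simp
  then have "sin (x + t) * a + sin x * b + (2 * (cos t * sin x) - 2 * sin (x + t)) * a
      = - (sin (t - x) * a + sin (- x) * b)" for a b
    by (simp add: left_diff_distrib sin_minus mult.commute[of a])
  from this[of "\<alpha> p k" "\<alpha> q k" for k] show ?thesis
    unfolding refl_eq L unfolding plane_def t_def[symmetric] by (simp add: fun_eq_iff)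
qed

lemma refl_plane_right:
  assumes "p < n" "q < n" shows "s q (plane p q x) = (\<lambda>k. - plane p q (- x - 2 * angle p q) k)"
proof -
  have swap: "plane q p (- x - angle p q) = (\<lambda>k. - plane p q x k)"
    using plane_swap[OF assms, of "- x - angle p q"] by simp
  have "s q (plane p q x) = (\<lambda>k. - s q (plane q p (- x - angle p q)) k)"
    using group_minus[OF refl_in_group[OF assms(2)], of "plane p q x"] by (simp add: swap)
  also have "\<dots> = (\<lambda>k. - plane p q (- x - 2 * angle p q) k)"
    unfolding refl_plane_left[OF assms(2,1)] unfolding plane_swap[OF assms] by (simp add: algebra_simps)
  finally show ?thesis .
qed

text \<open>\<open>s p\<close> and \<open>s q\<close> reflect the plane and their product turns it
  by twice the angle, so even words are rotations and odd words reflections.\<close>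

lemma alt_plane:
  assumes "p < n" "q < n"
  shows "alt p q k (plane p q x) =
    (if even k then plane p q (x + real k * angle p q)
     else (\<lambda>l. - plane p q (- x + (real k - 1) * angle p q) l))"
proof (induction k arbitrary: x)
  case (Suc k)
  have "alt p q k (\<lambda>l. - plane p q y l) = (\<lambda>l. - alt p q k (plane p q y) l)" for y
    by (rule group_minus) (simp add: alt_in_group assms)
  then show ?case
    using assms by (simp add: refl_plane_left refl_plane_right Suc algebra_simps)
qed simp

lemma plane_add_2pi: "plane p q (x + 2 * pi) = plane p q x"
proof -
  have "sin (x + 2 * pi + t) = sin (x + t)" for t
    using sin_periodic[of "x + t"] by (simp add: algebra_simps)
  then show ?thesis by (auto simp: plane_def)
qed

text \<open>Each reflection moves a vector by a multiple of its own root. Hence two alternating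
  images of \<open>x\<close> differ by a vector of the plane.\<close>

lemma alt_diff: "\<exists>a b. alt p q k x = (\<lambda>l. x l + a * \<alpha> p l + b * \<alpha> q l)"
proof (induction k arbitrary: p q)
  case 0
  have "alt p q 0 x = (\<lambda>l. x l + 0 * \<alpha> p l + 0 * \<alpha> q l)" by simp
  then show ?case by blast
next
  case (Suc k)
  then obtain a b where ab: "alt q p k x = (\<lambda>l. x l + a * \<alpha> q l + b * \<alpha> p l)" by blast
  have "alt p q (Suc k) x = (\<lambda>l. x l + (b - 2 * L p (alt q p k x)) * \<alpha> p l + a * \<alpha> q l)"
    unfolding alt_left comp_apply unfolding refl_eq[of p "alt q p k x"] by (auto simp: ab algebra_simps)
  then show ?case by blast
qed

text \<open>Both sides agree on the plane spanned by the two roots; their difference takes values in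
  this plane and is orthogonal to it.\<close>

lemma braid:
  assumes "p < n" "q < n" "p \<noteq> q"
  shows "alt p q (M p q) = alt q p (M p q)"
proof
  fix x
  define m where "m = M p q"
  define u v where "u = alt p q m" and "v = alt q p m"
  have mt: "real m * angle p q = pi" using M_angle[OF assms] by (simp add: m_def)
  have uG: "u \<in> G" "v \<in> G" using assms by (auto simp: u_def v_def alt_in_group)
  \<comment> \<open>As \<open>m\<close> times the angle is \<open>pi\<close>, both words act on the
    plane as the half turn (even \<open>m\<close>) or as one and the same reflection (odd
    \<open>m\<close>); the two computed angles differ by \<open>2 * pi\<close>.\<close>
  have uv: "u (plane p q y) = v (plane p q y)" for y
  proof -
    have "v (plane p q y) = v (\<lambda>k. - plane q p (- y - angle p q) k)"
      using plane_swap[OF assms(2,1)] assms by (simp add: angle_sym)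
    also have "\<dots> = (\<lambda>k. - v (plane q p (- y - angle p q)) k)"
      by (rule group_minus) fact
    finally have v: "v (plane p q y) = (\<lambda>k. - v (plane q p (- y - angle p q)) k)" .
    note v = v[unfolded v_def alt_plane[OF assms(2,1)], folded v_def]
    show ?thesis
    proof (cases "even m")
      case True
      have "plane p q (y + pi) = plane p q (y - pi)"
        using plane_add_2pi[of p q "y - pi"] by (simp add: algebra_simps)
      with True show ?thesis unfolding v
        using assms by (simp add: u_def v_def alt_plane angle_sym mt plane_swap[OF assms(1,2)])
    next
      case False
      have "plane p q (pi - (y + angle p q)) = plane p q (- pi - (y + angle p q))"
        using plane_add_2pi[of p q "- pi - (y + angle p q)"] by (simp add: algebra_simps)
      with False show ?thesis unfolding v
        using assms by (simp add: u_def v_def alt_plane angle_sym mt plane_swap[OF assms(1,2)] algebra_simps)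
    qed
  qed
  obtain a b where ab: "u x = (\<lambda>l. x l + a * \<alpha> p l + b * \<alpha> q l)" unfolding u_def using alt_diff by blast
  obtain c d where cd: "v x = (\<lambda>l. x l + c * \<alpha> q l + d * \<alpha> p l)" unfolding v_def using alt_diff by blast
  define z where "z = (\<lambda>l. 1 * u x l + (-1) * v x l)"
  have z: "z = (\<lambda>l. (a - d) * \<alpha> p l + (b - c) * \<alpha> q l)"
    by (auto simp: z_def ab cd algebra_simps)
  have "A z (plane p q y) = 0" for y
  proof -
    \<comment> \<open>\<open>u\<close> sends the point at \<open>y'\<close> to the point at
      \<open>y\<close>, up to the sign \<open>e\<close>; invariance of \<open>A\<close> under
      \<open>u\<close> and \<open>v\<close> then makes the two terms cancel.\<close>
    define y' where "y' = (if even m then y - real m * angle p q else - y + (real m - 1) * angle p q)"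
    define e where "e = (if even m then 1 else -1 :: real)"
    have *: "u (plane p q y') = (\<lambda>k. e * plane p q y k + 0 * plane p q y k)"
      using assms by (simp add: u_def alt_plane y'_def e_def algebra_simps)
    have "e * A z (plane p q y) = A z (u (plane p q y'))"
      unfolding * A_linear_right by simp
    also have "\<dots> = A (u x) (u (plane p q y')) - A (v x) (v (plane p q y'))"
      unfolding z_def A_linear by (simp add: uv)
    also have "\<dots> = 0" using uG by (simp add: A_group)
    finally show ?thesis by (auto simp: e_def split: if_splits)
  qed
  note orth = this
  from orth[of 0] orth[of "- angle p q"] have "A z (\<alpha> p) = 0" "A z (\<alpha> q) = 0"
    unfolding plane_0 plane_minus A_scale_right using sin_angle_pos[OF assms] by auto
  then have "A z (\<lambda>l. (a - d) * \<alpha> p l + (b - c) * \<alpha> q l) = 0" unfolding A_linear_right by simp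
  then have "A z z = 0" using z by simp
  then have "z k = 0" if "k < n" for k using A_pos[of k z] that by auto
  \<comment> \<open>\<open>A\<close> does not see the coordinates from \<open>n\<close> on, but the
    group fixes them.\<close>
  moreover have "z k = 0" if "k \<ge> n" for k using that uG by (simp add: z_def group_outside)
  ultimately have "z k = 0" for k by (cases "k < n") auto
  then have "u x k = v x k" for k by (simp add: z_def)
  then show "alt p q (M p q) x = alt q p (M p q) x" by (auto simp: u_def v_def m_def)
qed

text \<open>The descending walk \<open>w, w s\<^sub>t, w s\<^sub>t s\<^sub>i, \<dots>\<close> reaches, before \<open>m(t,i)\<close> steps, an element at
  which neither generator shortens further.\<close>

lemma simple_root_image_nonneg:
  "w \<in> G \<Longrightarrow> i < n \<Longrightarrow> len w \<le> len (w \<circ> s i) \<Longrightarrow> w (\<alpha> i) k \<ge> 0"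
proof (induction "len w" arbitrary: w i k rule: less_induct)
  case less
  show ?case
  proof (cases "len w")
    case 0
    then have "w = id" using words_len[OF less.prems(1)] by simp
    then show ?thesis by (simp add: simple_root_def)
  next
    case (Suc N)
    \<comment> \<open>\<open>t\<close> is the last letter of a shortest word, so \<open>s t\<close>
      shortens \<open>w\<close>, which \<open>s i\<close> does not.\<close>
    then obtain w' t where w': "w' \<in> words N" "t < n" "w = w' \<circ> s t"
      using words_len[OF less.prems(1)] by auto
    have 1: "len (w \<circ> s t) \<le> N" using w' len_le by (simp add: comp_refl_refl)
    then have "t \<noteq> i" using less.prems Suc by auto
    note ti = \<open>t < n\<close> \<open>i < n\<close> \<open>t \<noteq> i\<close>
    define m where "m = M t i"
    define P where "P j \<longleftrightarrow> len (w \<circ> alt t i j) + j = len w" for j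
    have P1: "P 1"
      using 1 Suc len_le_comp_refl[OF less.prems(1) ti(1)] by (simp add: P_def)
    have "m \<ge> 2" using M_ge2[OF ti] by (simp add: m_def)
    then obtain m' where m': "m = Suc m'" by (cases m) auto
    \<comment> \<open>If all \<open>m\<close> steps shortened, the braid relation would rewrite the
      walk to start with \<open>s i\<close>, and \<open>w \<circ> s i\<close> would be shorter than
      \<open>w\<close>.\<close>
    have "\<not> P m"
    proof
      assume "P m"
      have "w \<circ> alt t i m = (w \<circ> s i) \<circ> alt t i m'"
        using braid[OF ti] alt_left[of i t m'] by (simp add: m_def[symmetric] m' comp_assoc del: alt.simps)
      then have "len (w \<circ> s i) \<le> len (w \<circ> alt t i m) + m'"
        using len_alt(2)[of "w \<circ> s i" t i m'] ti less.prems(1) by (simp add: comp_in_group refl_in_group)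
      with \<open>P m\<close> less.prems(3) m' show False by (simp add: P_def)
    qed
    define k0 where "k0 = (LEAST j. \<not> P j)"
    have "\<not> P k0" "k0 \<le> m" unfolding k0_def by (rule LeastI, fact) (rule Least_le, fact)
    have below: "P j" if "j < k0" for j using not_less_Least that unfolding k0_def by blast
    have "P 0" by (simp add: P_def)
    with P1 \<open>\<not> P k0\<close> have "k0 \<noteq> 0" "k0 \<noteq> 1" by (metis, metis)
    then obtain k' where k0: "k0 = Suc (Suc k')" by (cases k0; cases "k0 - 1") auto
    \<comment> \<open>The last position before the first failing step. It is at least 1, so
      \<open>v\<close> below is strictly shorter than \<open>w\<close>.\<close>
    define K where "K = Suc k'"
    have PK: "P K" and PK': "P k'" using below by (auto simp: k0 K_def)
    have Km: "Suc K \<le> m" using \<open>k0 \<le> m\<close> by (simp add: k0 K_def)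
    define v where "v = w \<circ> alt t i K"
    have vG: "v \<in> G" using ti less.prems by (simp add: v_def comp_in_group alt_in_group)
    \<comment> \<open>\<open>r\<close> is the letter of the failing step, \<open>r'\<close> the
      letter just used. Neither shortens \<open>v\<close>, so the induction hypothesis covers both
      roots.\<close>
    define r r' where "r = (if even K then t else i)" and "r' = (if even k' then t else i)"
    have rr: "r < n" "r' < n" "{r, r'} = {t, i}" using ti by (auto simp: r_def r'_def K_def)
    have vK: "len v + K = len w" using PK by (simp add: P_def v_def)
    then have lt: "len v < len w" by (simp add: K_def)
    have "v \<circ> s r = w \<circ> alt t i k0" by (simp add: v_def k0 K_def r_def comp_assoc)
    then have "len v \<le> len (v \<circ> s r)"
      using \<open>\<not> P k0\<close> vK len_le_comp_refl[OF vG rr(1)] by (auto simp: P_def k0 K_def)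
    then have pos_r: "v (\<alpha> r) l \<ge> 0" for l using less.hyps[OF lt vG rr(1)] by blast
    have "v \<circ> s r' = (w \<circ> alt t i k') \<circ> s r' \<circ> s r'" by (simp add: v_def K_def r'_def comp_assoc)
    then have "v \<circ> s r' = w \<circ> alt t i k'" using rr by (simp add: comp_refl_refl)
    then have "len v \<le> len (v \<circ> s r')" using PK' vK by (simp add: P_def K_def)
    then have pos_r': "v (\<alpha> r') l \<ge> 0" for l using less.hyps[OF lt vG rr(2)] by blast
    have pos: "v (\<alpha> t) l \<ge> 0" "v (\<alpha> i) l \<ge> 0" for l
      using pos_r pos_r' rr(3) by (auto simp: doubleton_eq_iff)
    define \<theta> where "\<theta> = angle t i"
    have v_plane: "v (plane t i x) = (\<lambda>l. sin (x + \<theta>) * v (\<alpha> t) l + sin x * v (\<alpha> i) l)" for x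
      unfolding plane_def \<theta>_def using vG by (rule group_linear)
    have w_plane: "w (plane t i (- \<theta>)) = (\<lambda>l. - sin \<theta> * w (\<alpha> i) l)"
      unfolding plane_minus \<theta>_def using less.prems(1) by (rule group_scale)
    have sines: "sin (real K * \<theta>) \<ge> 0" "sin (real (Suc K) * \<theta>) \<ge> 0"
      using sin_multiple_nonneg[OF ti, of K] sin_multiple_nonneg[OF ti, of "Suc K"] Km
      unfolding \<theta>_def m_def by simp_all
    \<comment> \<open>The point at angle \<open>- \<theta>\<close> is \<open>- sin \<theta>\<close>
      times \<open>\<alpha> i\<close>. Pulled back through the alternating word, it expresses
      \<open>w (\<alpha> i)\<close> by the images under \<open>v\<close>, with coefficients that are
      nonnegative because \<open>Suc K \<le> m\<close>.\<close>
    have "sin \<theta> * w (\<alpha> i) k \<ge> 0"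
    proof (cases "even K")
      case True
      then have "alt t i K (plane t i (- (real (Suc K) * \<theta>))) = plane t i (- \<theta>)"
        using alt_plane[OF ti(1,2)] by (simp add: \<theta>_def algebra_simps)
      then have "v (plane t i (- (real (Suc K) * \<theta>))) = w (plane t i (- \<theta>))"
        by (simp add: v_def)
      from fun_cong[OF this, of k] have "sin \<theta> * w (\<alpha> i) k = sin (real K * \<theta>) * v (\<alpha> t) k + sin (real (Suc K) * \<theta>) * v (\<alpha> i) k"
        unfolding v_plane w_plane using sin_minus[of "\<theta> + real K * \<theta>"]
        by (simp add: distrib_right sin_minus)
      then show ?thesis using sines pos by simp
    next
      case False
      then have "alt t i K (plane t i (real K * \<theta>)) = (\<lambda>l. - plane t i (- \<theta>) l)"
        using alt_plane[OF ti(1,2)] by (simp add: \<theta>_def algebra_simps)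
      then have "v (plane t i (real K * \<theta>)) = (\<lambda>l. - w (plane t i (- \<theta>)) l)"
        using group_minus[OF less.prems(1)] by (simp add: v_def)
      from fun_cong[OF this, of k] have "sin \<theta> * w (\<alpha> i) k = sin (real (Suc K) * \<theta>) * v (\<alpha> t) k + sin (real K * \<theta>) * v (\<alpha> i) k"
        unfolding v_plane w_plane by (simp add: distrib_right add.commute)
      then show ?thesis using sines pos by simp
    qed
    then show ?thesis using sin_angle_pos[OF ti] by (simp add: \<theta>_def zero_le_mult_iff)
  qed
qed

text \<open>\<open>w\<close> and \<open>w \<circ> s i\<close> send \<open>\<alpha> i\<close> to
  opposite vectors, and \<open>simple_root_image_nonneg\<close> applies to the shorter of the
  two.\<close>

lemma root_sign:
  assumes "w \<in> G" "i < n"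
  shows "(\<forall>k. w (\<alpha> i) k \<ge> 0) \<or> (\<forall>k. w (\<alpha> i) k \<le> 0)"
proof (cases "len w \<le> len (w \<circ> s i)")
  case True
  then show ?thesis using simple_root_image_nonneg assms by blast
next
  case False
  then have "(w \<circ> s i) (\<alpha> i) k \<ge> 0" for k
    using assms by (intro simple_root_image_nonneg[of "w \<circ> s i"])
      (simp_all add: comp_refl_refl comp_in_group refl_in_group del: comp_apply)
  then show ?thesis using assms by (simp add: refl_simple_root group_minus)
qed

section \<open>Counting descents\<close>

text \<open>A linear functional that replaces the coordinatewise sign condition in
  \<open>cox_Des\<close> by the sign of one number.\<close>

definition height :: "(nat \<Rightarrow> real) \<Rightarrow> real" where "height x = (\<Sum>k<n. x k)"

lemma height_linear: "height (\<lambda>k. a * x k + b * y k) = a * height x + b * height y"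
  by (simp add: height_def sum.distrib sum_distrib_left)

lemma height_minus: "height (\<lambda>k. - x k) = - height x"
  by (simp add: height_def sum_negf)

lemma height_root:
  assumes "w \<in> G" "i < n"
  shows "height (w (\<alpha> i)) \<noteq> 0" "i \<in> cox_Des n w \<longleftrightarrow> height (w (\<alpha> i)) < 0"
proof -
  obtain k where k: "k < n" "w (\<alpha> i) k \<noteq> 0" using root_nonzero[OF assms] by blast
  have pos: "height (w (\<alpha> i)) > 0" if "\<forall>k. w (\<alpha> i) k \<ge> 0"
    unfolding height_def using that k
    by (intro sum_pos2[of _ k]) (auto simp: order_less_le)
  have neg: "height (w (\<alpha> i)) < 0" if "\<forall>k. w (\<alpha> i) k \<le> 0"
  proof -
    have "0 < (\<Sum>k<n. - w (\<alpha> i) k)"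
      using that k by (intro sum_pos2[of _ k]) (auto simp: order_less_le)
    then show ?thesis by (simp add: height_def sum_negf)
  qed
  show "height (w (\<alpha> i)) \<noteq> 0" using pos neg root_sign[OF assms] by fastforce
  show "i \<in> cox_Des n w \<longleftrightarrow> height (w (\<alpha> i)) < 0"
    using pos neg root_sign[OF assms] assms(2) unfolding cox_Des_def by fastforce
qed

lemma sum_comp_alt:
  assumes "p < n" "q < n"
  shows "(\<Sum>w\<in>G. F (w \<circ> alt p q k)) = (\<Sum>w\<in>G. F w)"
proof (induction k arbitrary: F)
  case (Suc k)
  define r where "r = (if even k then p else q)"
  have "(\<Sum>w\<in>G. F (w \<circ> alt p q (Suc k))) = (\<Sum>w\<in>G. F (w \<circ> alt p q k \<circ> s r))"
    by (simp add: r_def comp_assoc)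
  also have "\<dots> = (\<Sum>w\<in>G. F (w \<circ> s r))" by (rule Suc[of "\<lambda>w. F (w \<circ> s r)"])
  also have "\<dots> = (\<Sum>w\<in>G. F w)" using assms by (simp add: sum_comp_refl r_def)
  finally show ?case .
qed simp

lemma card_group_pos: "card G > 0"
  using fin cox_group.id_in by (auto simp: card_gt_0_iff)

text \<open>Right multiplication by \<open>s i\<close> sends the image of \<open>\<alpha> i\<close>
  to its negative, so it pairs elements with and without the descent.\<close>

lemma sum_descent:
  assumes i: "i < n"
  shows "(\<Sum>w\<in>G. of_bool (i \<in> cox_Des n w)) = real (card G) / 2"
proof -
  have "of_bool (i \<in> cox_Des n w) + of_bool (i \<in> cox_Des n (w \<circ> s i)) = (1 :: real)" if w: "w \<in> G" for w
  proof -
    have "height ((w \<circ> s i) (\<alpha> i)) = - height (w (\<alpha> i))"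
      using w i by (simp add: refl_simple_root group_minus height_minus)
    then show ?thesis
      using height_root[OF w i] height_root(2)[of "w \<circ> s i" i] w i
      by (auto simp: comp_in_group refl_in_group)
  qed
  then have "(\<Sum>w\<in>G. of_bool (i \<in> cox_Des n w) + of_bool (i \<in> cox_Des n (w \<circ> s i))) = real (card G)"
    by simp
  then show ?thesis
    unfolding sum.distrib sum_comp_refl[OF i, of "\<lambda>w. of_bool (i \<in> cox_Des n w)"] by simp
qed

text \<open>Along \<open>w alt\<^sub>0, w alt\<^sub>1, \<dots>\<close> the two simple roots sweep once around the plane they span, and
  both are descents exactly when the height changes sign from positive to negative.\<close>

lemma unique_alt_descent:
  assumes pq: "p < n" "q < n" "p \<noteq> q" and w: "w \<in> G"
  shows "\<exists>!k. k < 2 * M p q \<and> {p, q} \<subseteq> cox_Des n (w \<circ> alt p q k)"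
proof -
  define m where "m = M p q"
  define \<theta> where "\<theta> = angle p q"
  have m: "real m * \<theta> = pi" using M_angle[OF pq] by (simp add: m_def \<theta>_def)
  have \<theta>: "sin \<theta> > 0" using sin_angle_pos[OF pq] by (simp add: \<theta>_def)
  define f where "f x = height (w (plane p q x))" for x
  define a b where "a = height (w (\<alpha> p))" and "b = height (w (\<alpha> q))"
  have f_eq: "f x = sin (x + \<theta>) * a + sin x * b" for x
    unfolding f_def plane_def \<theta>_def a_def b_def group_linear[OF w] height_linear ..
  \<comment> \<open>The shift by one makes \<open>g 0\<close> and \<open>g 1\<close> the samples at
    \<open>- \<alpha> q\<close> and \<open>\<alpha> p\<close>, up to the factor
    \<open>sin \<theta>\<close>.\<close>
  define g where "g k = f ((real k - 1) * \<theta>)" for k :: nat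
  have altG: "w \<circ> alt p q k \<in> G" for k using pq w by (simp add: comp_in_group alt_in_group)
  define hp hq where "hp k = height ((w \<circ> alt p q k) (\<alpha> p))"
    and "hq k = height ((w \<circ> alt p q k) (\<alpha> q))" for k
  have hp: "height (w (alt p q k (plane p q 0))) = sin \<theta> * hp k" for k
    using group_scale[OF altG[of k], of "sin \<theta>" "\<alpha> p"] height_linear[of "sin \<theta>" _ 0 "\<lambda>_. 0"]
    by (simp add: plane_0 \<theta>_def hp_def)
  have hq: "height (w (alt p q k (plane p q (- \<theta>)))) = - sin \<theta> * hq k" for k
    using group_scale[OF altG[of k], of "- sin \<theta>" "\<alpha> q"] height_linear[of "- sin \<theta>" _ 0 "\<lambda>_. 0"]
    by (simp add: plane_minus \<theta>_def hq_def)
  \<comment> \<open>For even \<open>k\<close> the adjacent samples are the heights of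
    \<open>- \<alpha> q\<close> and \<open>\<alpha> p\<close> under the \<open>k\<close>-th element;
    for odd \<open>k\<close> order and signs are both reversed. Two descents thus mean a drop of
    \<open>g\<close> in either case.\<close>
  have cases: "if even k then sin \<theta> * hp k = g (Suc k) \<and> - sin \<theta> * hq k = g k
      else sin \<theta> * hp k = - g k \<and> - sin \<theta> * hq k = - g (Suc k)" for k
    unfolding hp[symmetric] hq[symmetric] alt_plane[OF pq(1,2)] g_def f_def
    using w by (simp add: group_minus height_minus \<theta>_def[symmetric] algebra_simps)
  have nz: "hp k \<noteq> 0" "hq k \<noteq> 0" for k
    using height_root(1)[OF altG] pq by (auto simp: hp_def hq_def)
  have Des: "{p, q} \<subseteq> cox_Des n (w \<circ> alt p q k) \<longleftrightarrow> hp k < 0 \<and> hq k < 0" for k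
    using height_root(2)[OF altG[of k]] pq by (auto simp: hp_def hq_def)
  have Des_g: "{p, q} \<subseteq> cox_Des n (w \<circ> alt p q k) \<longleftrightarrow> g k > 0 \<and> g (Suc k) < 0" for k
  proof (cases "even k")
    case True
    then have "g (Suc k) = sin \<theta> * hp k" "g k = - (sin \<theta> * hq k)" using cases[of k] by auto
    then show ?thesis unfolding Des using \<theta> by (auto simp: mult_less_0_iff)
  next
    case False
    then have "g k = - (sin \<theta> * hp k)" "g (Suc k) = sin \<theta> * hq k" using cases[of k] by auto
    then show ?thesis unfolding Des using \<theta> by (auto simp: mult_less_0_iff)
  qed
  have g_nz: "g k \<noteq> 0" for k
    using cases[of k] nz[of k] \<theta> by (auto split: if_splits)
  have g_anti: "g (k + m) = - g k" for k
  proof -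
    have "(real (k + m) - 1) * \<theta> = (real k - 1) * \<theta> + pi" using m by (simp add: algebra_simps)
    then have "g (k + m) = sin (((real k - 1) * \<theta> + \<theta>) + pi) * a + sin ((real k - 1) * \<theta> + pi) * b"
      by (simp add: g_def f_eq add_ac)
    then show ?thesis unfolding sin_periodic_pi by (simp add: g_def f_eq)
  qed
  have g_neg: "g (Suc k + j) < 0" if "g k > 0" "g (Suc k) < 0" "j < m" for k j
  proof -
    define x y where "x = (real k - 1) * \<theta>" and "y = real j * \<theta>"
    have gs: "g k = f x" "g (Suc k) = f (x + \<theta>)" "g (Suc k + j) = f (x + \<theta> + y)"
      by (simp_all add: g_def x_def y_def algebra_simps)
    \<comment> \<open>Three samples of a sinusoid are linearly related. For \<open>j < m\<close> the
      later value gets nonnegative weights on the negative numbers \<open>f (x + \<theta>)\<close>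
      and \<open>- f x\<close>; strictness comes from \<open>g_nz\<close>.\<close>
    have tri: "sin \<theta> * sin (z + \<theta> + y) = sin (y + \<theta>) * sin (z + \<theta>) - sin y * sin z" for z
      using sin_cos_squared_add3[of \<theta>] unfolding sin_add cos_add by algebra
    have "sin \<theta> * f (x + \<theta> + y) = sin (y + \<theta>) * f (x + \<theta>) - sin y * f x"
      using tri[of x] tri[of "x + \<theta>"] by (simp add: f_eq add_ac) algebra
    moreover have y: "sin y \<ge> 0" using sin_multiple_nonneg[OF pq, of j] that by (simp add: y_def \<theta>_def m_def)
    moreover have y\<theta>: "sin (y + \<theta>) \<ge> 0"
      using sin_multiple_nonneg[OF pq, of "Suc j"] that by (simp add: y_def \<theta>_def m_def algebra_simps)
    ultimately have "sin \<theta> * g (Suc k + j) \<le> 0"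
      using that gs by (smt (verit) mult_nonneg_nonneg mult_nonneg_nonpos)
    then show ?thesis using \<theta> g_nz[of "Suc k + j"] by (auto simp: mult_le_0_iff)
  qed
  show ?thesis
    unfolding Des_g m_def[symmetric] using unique_sign_change[of g m, OF g_anti g_nz g_neg] .
qed

text \<open>Double counting: each \<open>w\<close> has one good position
  \<open>k < 2 * M p q\<close>, while for fixed \<open>k\<close> right translation by the
  alternating word preserves the sum over the group.\<close>

lemma sum_descent_pair:
  assumes pq: "p < n" "q < n" "p \<noteq> q"
  shows "(\<Sum>w\<in>G. of_bool ({p, q} \<subseteq> cox_Des n w)) = real (card G) / (2 * real (M p q))"
proof -
  have "(\<Sum>k<2 * M p q. of_bool ({p, q} \<subseteq> cox_Des n (w \<circ> alt p q k))) = (1 :: real)" if wG: "w \<in> G" for w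
  proof -
    define P where "P k \<longleftrightarrow> {p, q} \<subseteq> cox_Des n (w \<circ> alt p q k)" for k
    obtain k where k: "k < 2 * M p q" "P k" "\<And>l. l < 2 * M p q \<Longrightarrow> P l \<Longrightarrow> l = k"
      using unique_alt_descent[OF pq wG] unfolding P_def[symmetric] by (elim ex1E) blast
    have "(\<Sum>l<2 * M p q. of_bool (P l)) = (\<Sum>l<2 * M p q. if l = k then 1 else 0 :: real)"
    proof (intro sum.cong refl)
      fix l assume "l \<in> {..<2 * M p q}"
      then have "P l \<longleftrightarrow> l = k" using k(2,3) by blast
      then show "of_bool (P l) = (if l = k then 1 else 0 :: real)" by simp
    qed
    then have "(\<Sum>l<2 * M p q. of_bool (P l)) = (1 :: real)" using k(1) by simp
    then show ?thesis unfolding P_def .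
  qed
  then have "real (card G) = (\<Sum>w\<in>G. \<Sum>k<2 * M p q. of_bool ({p, q} \<subseteq> cox_Des n (w \<circ> alt p q k)))"
    by (simp del: insert_subset)
  also have "\<dots> = (\<Sum>k<2 * M p q. \<Sum>w\<in>G. of_bool ({p, q} \<subseteq> cox_Des n (w \<circ> alt p q k)))"
    by (rule sum.swap)
  also have "\<dots> = (\<Sum>k<2 * M p q. \<Sum>w\<in>G. of_bool ({p, q} \<subseteq> cox_Des n w))"
    by (intro sum.cong refl sum_comp_alt[OF pq(1,2), of "\<lambda>w. of_bool ({p, q} \<subseteq> cox_Des n w)"])
  finally show ?thesis using M_ge2[OF pq] by (simp add: field_simps del: insert_subset)
qed

text \<open>Because \<open>M p p = 1\<close>, the single-descent probability 1/2 fits the same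
  formula.\<close>

lemma sum_descent_pair':
  assumes "p < n" "q < n"
  shows "(\<Sum>w\<in>G. of_bool (p \<in> cox_Des n w) * of_bool (q \<in> cox_Des n w)) =
    real (card G) / (2 * real (M p q))"
proof (cases "p = q")
  case True
  then show ?thesis using sum_descent[OF assms(1)] M_diag[OF assms(1)] by (simp flip: of_bool_conj)
next
  case False
  then show ?thesis using sum_descent_pair[OF assms False] by (simp flip: of_bool_conj)
qed

lemma cox_des_sum: "real (cox_des n w) = (\<Sum>i<n. of_bool (i \<in> cox_Des n w))"
proof -
  have "cox_Des n w \<subseteq> {..<n}" by (auto simp: cox_Des_def)
  then have "{..<n} \<inter> {i. i \<in> cox_Des n w} = cox_Des n w" by auto
  then show ?thesis by (simp add: cox_des_def of_bool_def sum.If_cases)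
qed

lemma des_mean_eq: "des_mean n M = real n / 2"
proof -
  have "(\<Sum>w\<in>G. real (cox_des n w)) = (\<Sum>i<n. \<Sum>w\<in>G. of_bool (i \<in> cox_Des n w))"
    unfolding cox_des_sum by (rule sum.swap)
  also have "\<dots> = real n * (real (card G) / 2)" by (simp add: sum_descent)
  finally show ?thesis using card_group_pos by (simp add: des_mean_def)
qed

text \<open>The sum of all covariances of the descent indicators, each of mean 1/2.\<close>

lemma des_var_eq: "des_var n M = (\<Sum>i<n. \<Sum>j<n. 1 / (2 * real (M i j)) - 1 / 4)"
proof -
  define D where "D i w = (of_bool (i \<in> cox_Des n w) :: real)" for i w
  have "(real (cox_des n w) - des_mean n M)\<^sup>2 = (\<Sum>i<n. \<Sum>j<n. (D i w - 1 / 2) * (D j w - 1 / 2))" for w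
    unfolding des_mean_eq cox_des_sum D_def[symmetric]
    by (simp add: sum_product[symmetric] sum_subtractf power2_eq_square)
  then have "(\<Sum>w\<in>G. (real (cox_des n w) - des_mean n M)\<^sup>2)
      = (\<Sum>w\<in>G. \<Sum>i<n. \<Sum>j<n. (D i w - 1 / 2) * (D j w - 1 / 2))" by simp
  also have "\<dots> = (\<Sum>i<n. \<Sum>j<n. \<Sum>w\<in>G. (D i w - 1 / 2) * (D j w - 1 / 2))"
    by (subst sum.swap, intro sum.cong refl, rule sum.swap)
  also have "\<dots> = (\<Sum>i<n. \<Sum>j<n. real (card G) * (1 / (2 * real (M i j)) - 1 / 4))"
  proof (intro sum.cong refl)
    fix i j assume "i \<in> {..<n}" "j \<in> {..<n}"
    then have ij: "i < n" "j < n" by auto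
    have "(\<Sum>w\<in>G. (D i w - 1 / 2) * (D j w - 1 / 2))
        = (\<Sum>w\<in>G. D i w * D j w) - (\<Sum>w\<in>G. D i w) / 2 - (\<Sum>w\<in>G. D j w) / 2 + real (card G) / 4"
      by (simp add: algebra_simps sum.distrib sum_subtractf sum_divide_distrib)
    also have "\<dots> = real (card G) * (1 / (2 * real (M i j)) - 1 / 4)"
      unfolding D_def using ij by (simp add: sum_descent_pair' sum_descent right_diff_distrib)
    finally show "(\<Sum>w\<in>G. (D i w - 1 / 2) * (D j w - 1 / 2)) = real (card G) * (1 / (2 * real (M i j)) - 1 / 4)" .
  qed
  finally show ?thesis using card_group_pos
    by (simp add: des_var_def flip: sum_distrib_left)
qed

section \<open>The Coxeter graph is a tree with at most one heavy edge\<close>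

lemma cox_bil_le: assumes "c > 0" "M i j \<ge> c" shows "cox_bil M i j \<le> - cos (pi / real c)"
  unfolding cox_bil_def using assms
  by (auto intro!: cos_monotone_0_pi_le simp: field_simps)

lemma cox_bil_nonpos: assumes "i < n" "j < n" "i \<noteq> j" shows "cox_bil M i j \<le> 0"
  using cox_bil_le[of 2 i j] M_ge2[OF assms] by simp

lemma Q_add: assumes "v < n" shows "Q (\<lambda>k. x k + t * \<alpha> v k) = Q x + t\<^sup>2 + 2 * t * L v x"
proof -
  have L: "L i (\<lambda>k. x k + t * \<alpha> v k) = L i x + t * cox_bil M i v" for i
    using L_linear[of i 1 x t "\<alpha> v"] assms by (simp add: L_simple_root)
  have "(\<Sum>i<n. x i * cox_bil M i v) = L v x"
    unfolding L_def by (rule sum.cong) (use assms in \<open>auto simp: cox_bil_sym\<close>)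
  moreover have "(\<Sum>i<n. \<alpha> v i * y i) = y v" for y
    using assms by (simp add: simple_root_def if_distrib[of "\<lambda>x. x * _"] cong: if_cong)
  moreover have "Q (\<lambda>k. x k + t * \<alpha> v k) = Q x + t * (\<Sum>i<n. x i * cox_bil M i v)
      + t * (\<Sum>i<n. \<alpha> v i * L i x) + t * t * (\<Sum>i<n. \<alpha> v i * cox_bil M i v)"
    by (simp add: Q_def L sum.distrib sum_distrib_left algebra_simps)
  ultimately show ?thesis using assms by (simp add: power2_eq_square cox_bil_diag)
qed

definition nonneg_on :: "nat set \<Rightarrow> (nat \<Rightarrow> real) \<Rightarrow> bool" where
  "nonneg_on T x \<longleftrightarrow> (\<forall>k. x k \<ge> 0) \<and> (\<forall>k. k \<notin> T \<longrightarrow> x k = 0)"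

text \<open>As \<open>v\<close> lies outside the support, only off-diagonal entries contribute and
  all terms are nonpositive; dropping some can only increase the sum.\<close>

lemma L_le:
  assumes "nonneg_on T x" "v < n" "v \<notin> T" "U \<subseteq> {..<n}"
  shows "L v x \<le> (\<Sum>u\<in>U. cox_bil M v u * x u)"
proof -
  have "cox_bil M v j * x j \<le> 0" if "j < n" for j
    using that assms cox_bil_nonpos[of v j] by (cases "j = v") (auto simp: nonneg_on_def mult_le_0_iff)
  then have "(\<Sum>j\<in>{..<n} - U. cox_bil M v j * x j) \<le> 0" by (intro sum_nonpos) auto
  then show ?thesis using sum.subset_diff[OF assms(4), of "\<lambda>j. cox_bil M v j * x j"] by (simp add: L_def)
qed

text \<open>The new vertex costs its norm \<open>t\<^sup>2\<close> and gains at least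
  \<open>2 * t * c\<close> along the edge to \<open>u\<close>; other edges only lower
  \<open>Q\<close>.\<close>

lemma Q_extend:
  assumes x: "nonneg_on T x" "x u \<ge> 1" and v: "v < n" "v \<notin> T" and u: "u < n" and t: "t > 0"
    and B: "cox_bil M v u \<le> - c" "c \<ge> 0"
  shows "Q (\<lambda>k. x k + t * \<alpha> v k) \<le> Q x + t\<^sup>2 - 2 * t * c"
proof -
  have "L v x \<le> cox_bil M v u * x u" using L_le[OF x(1) v, of "{u}"] u by simp
  also have "\<dots> \<le> - c * x u" using B x by (intro mult_right_mono) auto
  also have "\<dots> \<le> - c * 1" using B x by (intro mult_left_mono_neg) auto
  finally have "2 * t * L v x \<le> 2 * t * - c" using t by (intro mult_left_mono) auto
  then show ?thesis unfolding Q_add[OF v(1)] by simp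
qed

lemma nonneg_on_extend:
  "nonneg_on T x \<Longrightarrow> t > 0 \<Longrightarrow> nonneg_on (insert v T) (\<lambda>k. x k + t * \<alpha> v k)"
  by (auto simp: nonneg_on_def simple_root_def)

lemma nonneg_on_simple_root: "v \<in> T \<Longrightarrow> nonneg_on T (\<alpha> v)"
  by (auto simp: nonneg_on_def simple_root_def)

lemma simple_root_self: "\<alpha> v v = 1"
  by (simp add: simple_root_def)

lemma Q_simple_root: "v < n \<Longrightarrow> Q (\<alpha> v) = 1"
  using Q_add[of v "\<lambda>_. 0" 1] by (simp add: Q_def L_def)

lemma nonneg_on_mono: "nonneg_on T x \<Longrightarrow> T \<subseteq> T' \<Longrightarrow> nonneg_on T' x"
  by (auto simp: nonneg_on_def)

text \<open>\<open>paired\<close> forbids a second neighbour in \<open>T\<close> of an outside vertex, \<open>heavy\<close> forbids an edge of label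
  at least 4 leaving \<open>T\<close>: each would yield a nonzero vector with \<open>Q \<le> 0\<close>. Both properties survive
  adding a vertex adjacent to \<open>T\<close>.\<close>

definition paired :: "nat set \<Rightarrow> bool" where
  "paired T \<longleftrightarrow> (\<forall>u\<in>T. \<forall>z\<in>T. \<exists>x. nonneg_on T x \<and> x u \<ge> 1 \<and> x z \<ge> 1 \<and> Q x \<le> 1)"

definition heavy :: "nat set \<Rightarrow> bool" where
  "heavy T \<longleftrightarrow> (\<forall>u\<in>T. \<exists>x. nonneg_on T x \<and> x u \<ge> 1 \<and> Q x \<le> 1 / 2)"

text \<open>Coefficient 1 with edge bound 1/2 changes \<open>Q\<close> by at most
  \<open>1 - 1 = 0\<close> and leaves coefficient 1 at the new vertex, so the step can be
  repeated.\<close>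

lemma extend_by_edge:
  assumes T: "T \<subseteq> {..<n}" and v: "v < n" "v \<notin> T" and u: "u \<in> T" "M v u \<ge> 3"
    and x: "nonneg_on T x" "x u \<ge> 1"
  shows "\<exists>y. nonneg_on (insert v T) y \<and> y v \<ge> 1 \<and> (\<forall>k. y k \<ge> x k) \<and> Q y \<le> Q x"
proof (intro exI conjI allI)
  let ?y = "\<lambda>k. x k + 1 * \<alpha> v k"
  show "nonneg_on (insert v T) ?y" using x by (intro nonneg_on_extend) auto
  show "?y v \<ge> 1" using x by (auto simp: nonneg_on_def simple_root_def)
  show "?y k \<ge> x k" for k by (simp add: simple_root_def)
  show "Q ?y \<le> Q x"
    using Q_extend[OF x v, of 1 "1 / 2"] cox_bil_le[of 3 v u] u T by (auto simp: cos_60)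
qed

text \<open>For a pair of \<open>v\<close> and an old vertex \<open>z\<close>, the witness for
  \<open>u\<close> and \<open>z\<close> is extended across the edge from \<open>u\<close> to
  \<open>v\<close>.\<close>

lemma paired_insert:
  assumes T: "T \<subseteq> {..<n}" "paired T" and v: "v < n" "v \<notin> T" and u: "u \<in> T" "M v u \<ge> 3"
  shows "paired (insert v T)"
proof -
  have new: "\<exists>x. nonneg_on (insert v T) x \<and> x v \<ge> 1 \<and> x z \<ge> 1 \<and> Q x \<le> 1" if z: "z \<in> T" for z
  proof -
    obtain x where x: "nonneg_on T x" "x u \<ge> 1" "x z \<ge> 1" "Q x \<le> 1"
      using T(2) u(1) z unfolding paired_def by blast
    from extend_by_edge[OF T(1) v u x(1,2)] x(3,4) show ?thesis by (meson order_trans)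
  qed
  have "\<exists>x. nonneg_on (insert v T) x \<and> x y \<ge> 1 \<and> x z \<ge> 1 \<and> Q x \<le> 1"
    if yz: "y \<in> insert v T" "z \<in> insert v T" for y z
  proof -
    consider "y = v" "z = v" | "y = v" "z \<in> T" | "y \<in> T" "z = v" | "y \<in> T" "z \<in> T"
      using yz by blast
    then show ?thesis
    proof cases
      case 1
      then show ?thesis
        using nonneg_on_simple_root[of v "insert v T"] Q_simple_root[OF v(1)]
        by (intro exI[of _ "\<alpha> v"]) (auto simp: simple_root_def)
    next
      case 4
      then show ?thesis using T(2) unfolding paired_def by (meson nonneg_on_mono subset_insertI)
    qed (use new in blast)+
  qed
  then show ?thesis unfolding paired_def by blast
qed

lemma heavy_insert:
  assumes T: "T \<subseteq> {..<n}" "heavy T" and v: "v < n" "v \<notin> T" and u: "u \<in> T" "M v u \<ge> 3"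
  shows "heavy (insert v T)"
  unfolding heavy_def
proof
  fix y assume y: "y \<in> insert v T"
  show "\<exists>x. nonneg_on (insert v T) x \<and> x y \<ge> 1 \<and> Q x \<le> 1 / 2"
  proof (cases "y = v")
    case True
    obtain x where x: "nonneg_on T x" "x u \<ge> 1" "Q x \<le> 1 / 2"
      using T(2) u(1) unfolding heavy_def by blast
    from extend_by_edge[OF T(1) v u x(1,2)] x(3) True show ?thesis by (meson order_trans)
  next
    case False
    then show ?thesis using T(2) y unfolding heavy_def by (metis insertE nonneg_on_mono subset_insertI)
  qed
qed

lemma heavy_edge:
  assumes "a < n" "b < n" "a \<noteq> b" "M a b \<ge> 4"
  shows "heavy {a, b}"
proof -
  have *: "\<exists>x. nonneg_on {c, d} x \<and> x c \<ge> 1 \<and> Q x \<le> 1 / 2"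
    if cd: "c < n" "d < n" "c \<noteq> d" "M d c \<ge> 4" for c d
  proof (intro exI conjI)
    \<comment> \<open>The coefficient \<open>sqrt 2 / 2 = cos (pi / 4)\<close> minimises the bound,
      which becomes \<open>1 + 1 / 2 - 1\<close>.\<close>
    let ?x = "\<lambda>k. \<alpha> c k + (sqrt 2 / 2) * \<alpha> d k"
    show "nonneg_on {c, d} ?x" "?x c \<ge> 1" using cd by (auto simp: nonneg_on_def simple_root_def)
    have "Q ?x \<le> Q (\<alpha> c) + (sqrt 2 / 2)\<^sup>2 - 2 * (sqrt 2 / 2) * (sqrt 2 / 2)"
      using cox_bil_le[of 4 d c] cd nonneg_on_simple_root[of c "{c}"]
      by (intro Q_extend[of "{c}" _ c]) (auto simp: simple_root_self cos_45)
    then show "Q ?x \<le> 1 / 2" using cd by (simp add: Q_simple_root power2_eq_square)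
  qed
  show ?thesis unfolding heavy_def using *[of a b] *[of b a] assms M_sym
    by (auto simp: insert_commute)
qed

text \<open>Excludes cycles: with two neighbours \<open>L v x \<le> - 1\<close>, so adding
  \<open>\<alpha> v\<close> to a witness gives \<open>Q\<close> at most
  \<open>1 + 1 - 2 = 0\<close>, against \<open>Q_pos\<close>.\<close>

lemma paired_unique_neighbour:
  assumes irr: "coxeter_irreducible n M" and T: "T \<subseteq> {..<n}" "paired T" and v: "v < n" "v \<notin> T"
    and u: "u \<in> T" "M v u \<ge> 3" and z: "z \<in> T" "M v z \<ge> 3"
  shows "u = z"
proof (rule ccontr)
  assume "u \<noteq> z"
  obtain x where x: "nonneg_on T x" "x u \<ge> 1" "x z \<ge> 1" "Q x \<le> 1"
    using T(2) u(1) z(1) unfolding paired_def by blast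
  have B: "cox_bil M v w \<le> - (1 / 2)" if "M v w \<ge> 3" for w
    using cox_bil_le[of 3 v w] that by (simp add: cos_60)
  have Bx: "cox_bil M v w * x w \<le> - (1 / 2)" if "M v w \<ge> 3" "x w \<ge> 1" for w
    using mult_mono[of "1 / 2" "- cox_bil M v w" 1 "x w"] B[OF that(1)] that(2) by simp
  have "L v x \<le> cox_bil M v u * x u + cox_bil M v z * x z"
    using L_le[OF x(1) v, of "{u, z}"] u z T \<open>u \<noteq> z\<close> by auto
  then have "L v x \<le> - 1" using Bx[OF u(2) x(2)] Bx[OF z(2) x(3)] by simp
  then have "Q (\<lambda>k. x k + 1 * \<alpha> v k) \<le> 0" unfolding Q_add[OF v(1)] using x by simp
  moreover have "x v + 1 * \<alpha> v v \<noteq> 0" using x v by (simp add: nonneg_on_def simple_root_def)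
  ultimately show False using Q_pos[OF irr v(1), of "\<lambda>k. x k + 1 * \<alpha> v k"] by simp
qed

text \<open>Excludes a second heavy edge: extending a witness by \<open>sqrt 2 / 2\<close> at
  \<open>v\<close> gives \<open>Q\<close> at most \<open>1 / 2 + 1 / 2 - 1 = 0\<close>.\<close>

lemma heavy_light_neighbour:
  assumes irr: "coxeter_irreducible n M" and T: "T \<subseteq> {..<n}" "heavy T" and v: "v < n" "v \<notin> T"
    and u: "u \<in> T"
  shows "M v u < 4"
proof (rule ccontr)
  assume "\<not> M v u < 4"
  obtain x where x: "nonneg_on T x" "x u \<ge> 1" "Q x \<le> 1 / 2"
    using T(2) u(1) unfolding heavy_def by blast
  have "Q (\<lambda>k. x k + (sqrt 2 / 2) * \<alpha> v k) \<le> Q x + (sqrt 2 / 2)\<^sup>2 - 2 * (sqrt 2 / 2) * (sqrt 2 / 2)"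
    using cox_bil_le[of 4 v u] \<open>\<not> M v u < 4\<close> u T
    by (intro Q_extend[OF x(1,2) v]) (auto simp: cos_45)
  then have "Q (\<lambda>k. x k + (sqrt 2 / 2) * \<alpha> v k) \<le> 0" using x by (simp add: power2_eq_square)
  moreover have "x v + (sqrt 2 / 2) * \<alpha> v v \<noteq> 0" using x v by (simp add: nonneg_on_def simple_root_def)
  ultimately show False using Q_pos[OF irr v(1), of "\<lambda>k. x k + (sqrt 2 / 2) * \<alpha> v k"] by simp
qed

section \<open>Summing the covariances along a growing tree\<close>

definition cov_sum :: "nat set \<Rightarrow> real" where
  "cov_sum T = (\<Sum>i\<in>T. \<Sum>j\<in>T. 1 / (2 * real (M i j)) - 1 / 4)"

lemma cov_sum_insert:
  assumes "T \<subseteq> {..<n}" "v < n" "v \<notin> T"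
  shows "cov_sum (insert v T) = cov_sum T + 1 / 4 + 2 * (\<Sum>j\<in>T. 1 / (2 * real (M v j)) - 1 / 4)"
proof -
  have "finite T" using assms(1) finite_subset by blast
  moreover have "(\<Sum>i\<in>T. 1 / (2 * real (M i v)) - 1 / 4) = (\<Sum>j\<in>T. 1 / (2 * real (M v j)) - 1 / 4)"
    by (rule sum.cong) (use assms M_sym in auto)
  ultimately show ?thesis using assms M_diag[OF assms(2)]
    by (simp add: cov_sum_def sum.distrib)
qed

lemma irreducible_crossing_edge:
  assumes "coxeter_irreducible n M" "a < n" "a \<in> T" "z < n" "z \<notin> T"
  shows "\<exists>u v. u \<in> T \<and> v \<notin> T \<and> u < n \<and> v < n \<and> M u v \<ge> 3"
proof -
  have "(a, z) \<in> {(a, b). a < n \<and> b < n \<and> M a b \<ge> 3}\<^sup>*"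
    using assms by (simp add: coxeter_irreducible_def)
  then show ?thesis using assms(5)
  proof (induction rule: rtrancl_induct)
    case base
    then show ?case using assms by simp
  next
    case (step y z)
    then show ?case by blast
  qed
qed

text \<open>Irreducibility always supplies an edge leaving \<open>T\<close>, and its outer end is
  added. \<open>paired\<close> and \<open>heavy\<close> are carried along as invariants, the latter
  only if the largest label is at least 4.\<close>

lemma cov_sum_grow:
  assumes irr: "coxeter_irreducible n M" and ab: "a < n" "b < n" "a \<noteq> b" "M a b \<ge> 3"
    and max: "\<And>i j. i < n \<Longrightarrow> j < n \<Longrightarrow> M i j \<le> M a b"
    and k: "k + 2 \<le> n"
  shows "\<exists>T \<subseteq> {..<n}. card T = k + 2 \<and> a \<in> T \<and> paired T \<and> (M a b \<ge> 4 \<longrightarrow> heavy T)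
    \<and> cov_sum T = real k / 12 + 1 / real (M a b)"
  using k
proof (induction k)
  case 0
  have "paired {b}"
    unfolding paired_def using nonneg_on_simple_root[of b "{b}"] Q_simple_root[OF ab(2)]
    by (auto simp: simple_root_def intro!: exI[of _ "\<alpha> b"])
  then have "paired {a, b}" by (rule paired_insert[of "{b}" a b, rotated]) (use ab in auto)
  \<comment> \<open>The diagonal gives 1/4 twice, which cancels the constants of the two
    off-diagonal terms.\<close>
  moreover have "cov_sum {a, b} = 1 / real (M a b)"
    using cov_sum_insert[of "{b}" a] ab M_diag[of b] by (simp add: cov_sum_def)
  ultimately show ?case using ab heavy_edge by (intro exI[of _ "{a, b}"]) auto
next
  case (Suc k)
  then obtain T where T: "T \<subseteq> {..<n}" "card T = k + 2" "a \<in> T" "paired T" "M a b \<ge> 4 \<longrightarrow> heavy T"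
    "cov_sum T = real k / 12 + 1 / real (M a b)" by auto
  have fT: "finite T" using T(1) finite_subset by blast
  have "T \<noteq> {..<n}" using T(2) Suc.prems by auto
  then obtain z where "z < n" "z \<notin> T" using T(1) by auto
  then obtain u v where uv: "u \<in> T" "v \<notin> T" "u < n" "v < n" "M u v \<ge> 3"
    using irreducible_crossing_edge[OF irr ab(1) T(3)] by blast
  have vu: "M v u \<ge> 3" using uv M_sym by simp
  \<comment> \<open>Either \<open>T\<close> is heavy, which rules out label 4 or more, or the
    largest label is itself 3.\<close>
  have M3: "M v u = 3"
    using heavy_light_neighbour[OF irr T(1) _ uv(4,2,1)] T(5) max[OF uv(4,3)] vu by force
  have M2: "M v j = 2" if "j \<in> T" "j \<noteq> u" for j
    using paired_unique_neighbour[OF irr T(1,4) uv(4,2,1) vu that(1)] M_ge2[OF uv(4), of j] that T(1) uv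
    by force
  \<comment> \<open>Label 3 gives \<open>1 / 6 - 1 / 4 = - 1 / 12\<close>; label 2 gives 0.\<close>
  have "(\<Sum>j\<in>T. 1 / (2 * real (M v j)) - 1 / 4) = (\<Sum>j\<in>T. if j = u then - (1 / 12) else 0)"
    by (rule sum.cong) (use M2 M3 in auto)
  then have "cov_sum (insert v T) = real (Suc k) / 12 + 1 / real (M a b)"
    using cov_sum_insert[OF T(1) uv(4,2)] T(6) uv(1) fT by simp
  then show ?case
    using T uv fT paired_insert[OF T(1,4) uv(4,2,1) vu] heavy_insert[OF T(1) _ uv(4,2,1) vu]
    by (intro exI[of _ "insert v T"]) auto
qed

end

theorem theorem4p1:
  fixes n :: nat and M :: "nat \<Rightarrow> nat \<Rightarrow> nat"
  assumes "coxeter_matrix n M"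
    and "coxeter_irreducible n M"
    and "finite (cox_group n M)"
    and "n \<ge> 2"
  shows "des_mean n M = real n / 2
    \<and> des_var n M = (real n - 2) / 12
        + 1 / real (Max {M i j | i j. i < n \<and> j < n})"
proof -
  interpret finite_coxeter n M using assms by unfold_locales
  define S where "S = {M i j | i j. i < n \<and> j < n}"
  have "S = (\<lambda>(i, j). M i j) ` ({..<n} \<times> {..<n})" by (auto simp: S_def)
  then have S: "finite S" by simp
  \<comment> \<open>Rank at least 2 and connectedness give a label of at least 3, so the maximum is
    not attained on the diagonal.\<close>
  obtain u v where uv: "u < n" "v < n" "M u v \<ge> 3"
    using irreducible_crossing_edge[OF assms(2), of 0 "{0}" 1] assms(4) by auto
  then have "M u v \<in> S" by (auto simp: S_def)
  then have Max: "Max S \<in> S" "Max S \<ge> 3"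
    using Max_in[OF S] Max_ge[OF S, of "M u v"] uv(3) by auto
  then obtain a b where ab: "a < n" "b < n" "Max S = M a b" by (auto simp: S_def)
  have "a \<noteq> b" using Max(2) ab M_diag by auto
  have "M i j \<le> M a b" if "i < n" "j < n" for i j
    using Max_ge[OF S, of "M i j"] that ab(3) by (auto simp: S_def)
  \<comment> \<open>Growing by \<open>n - 2\<close> vertices exhausts the graph.\<close>
  moreover have "M a b \<ge> 3" "n - 2 + 2 \<le> n" using Max(2) ab(3) assms(4) by simp_all
  ultimately obtain T where T: "T \<subseteq> {..<n}" "card T = n - 2 + 2"
    "cov_sum T = real (n - 2) / 12 + 1 / real (M a b)"
    using cov_sum_grow[OF assms(2) ab(1,2) \<open>a \<noteq> b\<close>] by blast
  then have "T = {..<n}" using assms(4) by (intro card_subset_eq) auto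
  then have "des_var n M = (real n - 2) / 12 + 1 / real (Max S)"
    using T(3) ab(3) assms(4) by (simp add: des_var_eq cov_sum_def of_nat_diff)
  then show ?thesis by (simp add: des_mean_eq S_def)
qed

end
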